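(* Let $k$ be a positive integer, $r$ a nonnegative integer and $x=(x_1,\dots,x_n)$. Then $$P_{(k^r)}(x;t)=\sum_{\substack{y_1,\dots,y_k\in\mathbb{Z}\\ y_1+\dots+y_k=0}}\ \det_{1\leq i,j\leq k}\Bigl(t^{k\binom{y_i}{2}+iy_i}\, e_{r-i+j-ky_i}(x)\Bigr).$$
   Context: For a partition $\lambda$, $l(\lambda)$ is its number of (positive) parts and $m_i(\lambda)$ the multiplicity of parts equal to $i$. $(k^r)=(k,\dots,k)$ is the partition with $r$ parts all equal to $k$. $\binom{u}{2}=u(u-1)/2$ for $u\in\mathbb{Z}$. $e_r(x)$ is the $r$-th elementary symmetric polynomial in $x_1,\dots,x_n$, with $e_0=1$ and $e_r(x)=0$ for $r<0$ or $r>n$ (so only finitely many terms of the sum are nonzero). Let $(t;t)_m=\prod_{i=1}^m(1-t^i)$. For $l(\lambda)\le n$ the Hall–Littlewood polynomial is $$P_{\lambda}(x;t)=\frac{1}{v_{\lambda}(t)}\sum_{w\in S_n} w\biggl(x_1^{\lambda_1}\cdots x_n^{\lambda_n}\prod_{1\leq i<j\leq n}\frac{x_i-tx_j}{x_i-x_j}\biggr),\qquad v_{\lambda}(t)=\frac{(t;t)_{n-l(\lambda)}}{(1-t)^{n-l(\lambda)}}\prod_{i\geq 1}\frac{(t;t)_{m_i(\lambda)}}{(1-t)^{m_i(\lambda)}},$$ where $S_n$ acts by permuting the variables; $P_\lambda(x;t)=0$ if $l(\lambda)>n$. *)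

theory Defs
  imports
    "HOL-Library.Poly_Mapping"
    "HOL-Library.FuncSet"
    "HOL-Computational_Algebra.Polynomial_Factorial"
    "HOL-Combinatorics.Permutations"
    "Jordan_Normal_Form.Determinant"
begin

text \<open>
  The polynomials in question are elements of the field of fractions of
  \<open>\<int>[t][x\<^sub>0, x\<^sub>1, x\<^sub>2, \<dots>]\<close>, where the quotients
  \<open>(x\<^sub>i - t x\<^sub>j) / (x\<^sub>i - x\<^sub>j)\<close> make sense. A monomial is a finitely supported
  exponent function, a polynomial a finitely supported coefficient function on monomials;
  only \<open>x\<^sub>1, \<dots>, x\<^sub>n\<close> are used.
\<close>

type_synonym ratfun = "((nat \<Rightarrow>\<^sub>0 nat) \<Rightarrow>\<^sub>0 int poly) fract"

definition xvar :: "nat \<Rightarrow> ratfun" where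
  "xvar i = to_fract (Poly_Mapping.single (Poly_Mapping.single i 1) 1)"

definition tvar :: ratfun where
  "tvar = to_fract (Poly_Mapping.single 0 [:0, 1:])"

definition elem_sym :: "nat \<Rightarrow> (nat \<Rightarrow> 'a::comm_ring_1) \<Rightarrow> int \<Rightarrow> 'a" where
  "elem_sym n x r = (if r < 0 then 0
     else (\<Sum>S | S \<subseteq> {1..n} \<and> card S = nat r. \<Prod>i\<in>S. x i))"

definition is_partition :: "nat list \<Rightarrow> bool" where
  "is_partition la \<longleftrightarrow> sorted_wrt (\<ge>) la \<and> 0 \<notin> set la"

definition part :: "nat list \<Rightarrow> nat \<Rightarrow> nat" where
  "part la i = (if 1 \<le> i \<and> i \<le> length la then la ! (i - 1) else 0)"

definition qpoch :: "'a::comm_ring_1 \<Rightarrow> nat \<Rightarrow> 'a" where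
  "qpoch t m = (\<Prod>i=1..m. 1 - t ^ i)"

text \<open>In the product over \<open>i \<ge> 1\<close> only the values \<open>i\<close> occurring as parts
  contribute; the other factors are \<open>1\<close>.\<close>

definition hl_v :: "nat \<Rightarrow> nat list \<Rightarrow> 'a::field \<Rightarrow> 'a" where
  "hl_v n la t =
     qpoch t (n - length la) / (1 - t) ^ (n - length la) *
     (\<Prod>i\<in>set la. qpoch t (count_list la i) / (1 - t) ^ count_list la i)"

definition hl_term :: "nat \<Rightarrow> nat list \<Rightarrow> (nat \<Rightarrow> 'a::field) \<Rightarrow> 'a \<Rightarrow> 'a" where
  "hl_term n la x t =
     (\<Prod>i=1..n. x i ^ part la i) *
     (\<Prod>(i,j) | 1 \<le> i \<and> i < j \<and> j \<le> n. (x i - t * x j) / (x i - x j))"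

text \<open>The Hall--Littlewood polynomial of a partition (a weakly decreasing list of positive
  integers) in the variables \<open>x\<^sub>1, \<dots>, x\<^sub>n\<close>. A permutation \<open>w\<close> acts by replacing each
  \<open>x\<^sub>i\<close> by the variable with index \<open>w i\<close>. Over an arbitrary field the formula is
  meaningful only if the \<open>x\<^sub>i\<close> are distinct and \<open>t\<close> is not a root of unity;
  this holds for the indeterminates \<^term>\<open>xvar\<close> and \<^term>\<open>tvar\<close>, see below.\<close>

definition hall_littlewood :: "nat \<Rightarrow> nat list \<Rightarrow> (nat \<Rightarrow> 'a::field) \<Rightarrow> 'a \<Rightarrow> 'a" where
  "hall_littlewood n la x t = (if length la > n then 0
     else (1 / hl_v n la t) * (\<Sum>w | w permutes {1..n}. hl_term n la (x \<circ> w) t))"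

text \<open>Determinant of \<open>(A i j)\<close> for \<open>1 \<le> i, j \<le> k\<close>; the matrices of the library are
  indexed from \<open>0\<close>.\<close>

definition det1 :: "nat \<Rightarrow> (nat \<Rightarrow> nat \<Rightarrow> 'a::comm_ring_1) \<Rightarrow> 'a" where
  "det1 k A = det (mat k k (\<lambda>(i,j). A (i + 1) (j + 1)))"

lemma is_partition_replicate: "k > 0 \<Longrightarrow> is_partition (replicate r k)"
  by (auto simp: is_partition_def sorted_wrt_iff_nth_less)

lemma xvar_eq_iff [simp]: "xvar i = xvar j \<longleftrightarrow> i = j"
proof
  assume "xvar i = xvar j"
  then have "Poly_Mapping.single (Poly_Mapping.single i (1::nat)) (1::int poly) =
             Poly_Mapping.single (Poly_Mapping.single j 1) 1"
    by (simp add: xvar_def)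
  then have "Poly_Mapping.lookup (Poly_Mapping.single (Poly_Mapping.single i (1::nat)) (1::int poly))
               (Poly_Mapping.single j 1) = 1"
    by (simp only: lookup_single_eq)
  then have "Poly_Mapping.single i (1::nat) = Poly_Mapping.single j 1"
    by (simp only: lookup_single when_def zero_neq_one split: if_splits)
  then have "Poly_Mapping.lookup (Poly_Mapping.single i (1::nat)) j = 1"
    by (simp only: lookup_single_eq)
  then show "i = j"
    by (simp only: lookup_single when_def zero_neq_one split: if_splits)
qed simp

lemma tvar_power_neq_1:
  assumes "i > 0" shows "tvar ^ i \<noteq> 1"
proof
  assume *: "tvar ^ i = 1"
  define s :: "(nat \<Rightarrow>\<^sub>0 nat) \<Rightarrow>\<^sub>0 int poly" where "s = Poly_Mapping.single 0 [:0, 1:]"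
  have pw: "s ^ m = Poly_Mapping.single 0 ([:0, 1:] ^ m)" for m
    by (induction m) (simp_all add: s_def mult_single)
  have tf: "to_fract s ^ m = to_fract (s ^ m)" for m
    by (induction m) simp_all
  have "to_fract (s ^ i) = to_fract 1"
    using * tf[of i] by (simp add: tvar_def s_def)
  then have "s ^ i = 1" by (simp only: to_fract_eq_iff)
  then have "Poly_Mapping.lookup (s ^ i) 0 = 1" by simp
  then have "[:0, 1::int:] ^ i = 1" by (simp add: pw)
  then have "poly ([:0, 1::int:] ^ i) 0 = 1" by simp
  then show False using assms by (simp add: power_0_left)
qed

lemma elem_sym_eq_0: "r < 0 \<or> r > int n \<Longrightarrow> elem_sym n x r = 0"
proof -
  assume r: "r < 0 \<or> r > int n"
  have "card S \<le> n" if "S \<subseteq> {1..n}" for S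
    using card_mono[OF finite_atLeastAtMost that] by (simp only: card_atLeastAtMost diff_Suc_1)
  then have "{S. S \<subseteq> {1..n} \<and> card S = nat r} = {}" if "r > int n"
    using that by (metis (mono_tags, lifting) empty_Collect_eq nat_less_iff not_le zless_nat_conj
        zless_nat_eq_int_zless)
  then show ?thesis
    using r unfolding elem_sym_def by (metis sum.empty)
qed

lemma det1_zero_row:
  assumes "i \<in> {1..k}" "\<And>j. j \<in> {1..k} \<Longrightarrow> A i j = 0"
  shows "det1 k A = 0"
proof -
  have "(\<Prod>l = 0..<k. mat k k (\<lambda>(i, j). A (i + 1) (j + 1)) $$ (l, p l)) = 0"
    if p: "p permutes {0..<k}" for p
  proof (rule prod_zero)
    have "i - 1 \<in> {0..<k}" using assms(1) by auto
    moreover from this have "p (i - 1) \<in> {0..<k}" using p by (simp add: permutes_in_image)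
    ultimately show "\<exists>l\<in>{0..<k}. mat k k (\<lambda>(i, j). A (i + 1) (j + 1)) $$ (l, p l) = 0"
      using assms by (intro bexI[of _ "i - 1"]) auto
  qed simp
  then show ?thesis by (simp add: det1_def det_def)
qed

text \<open>The determinants below are indexed by an infinite set of tuples when \<open>k > 1\<close>. By the
  following lemma, the library's finite-support sum \<^const>\<open>sum'\<close> over that set is the sum of
  all nonzero terms, not the default value \<open>0\<close>.\<close>

lemma finite_det_support:
  fixes x :: "nat \<Rightarrow> 'a::field"
  assumes "k > 0"
  shows "finite {y \<in> {y \<in> {1..k} \<rightarrow>\<^sub>E (UNIV :: int set). (\<Sum>i=1..k. y i) = 0}.
    det1 k (\<lambda>i j.
      t powi (int k * ((y i * (y i - 1)) div 2) + int i * y i) *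
      elem_sym n x (int r - int i + int j - int k * y i)) \<noteq> 0}" (is "finite ?S")
proof (rule finite_subset)
  let ?B = "{- int (k + n) .. int (r + k)}"
  show "finite ({1..k} \<rightarrow>\<^sub>E ?B)" by (intro finite_PiE) auto
  show "?S \<subseteq> {1..k} \<rightarrow>\<^sub>E ?B"
  proof
    fix y assume y: "y \<in> ?S"
    have "y i \<in> ?B" if i: "i \<in> {1..k}" for i
    proof -
      have "\<exists>j\<in>{1..k}. elem_sym n x (int r - int i + int j - int k * y i) \<noteq> 0"
      proof (rule ccontr)
        assume "\<not> ?thesis"
        then have "det1 k (\<lambda>i j.
          t powi (int k * ((y i * (y i - 1)) div 2) + int i * y i) *
          elem_sym n x (int r - int i + int j - int k * y i)) = 0"
          by (intro det1_zero_row[OF i]) simp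
        with y show False by simp
      qed
      then obtain j where j: "j \<in> {1..k}"
        and nz: "elem_sym n x (int r - int i + int j - int k * y i) \<noteq> 0"
        by blast
      have "\<not> (int r - int i + int j - int k * y i < 0 \<or>
               int r - int i + int j - int k * y i > int n)"
        using nz elem_sym_eq_0 by blast
      then have b: "0 \<le> int r - int i + int j - int k * y i"
        "int r - int i + int j - int k * y i \<le> int n"
        by (simp_all only: not_less de_Morgan_disj)
      have u: "int k * y i \<le> int (r + k)" and l: "- int (k + n) \<le> int k * y i"
        using b i j by auto
      have "y i \<le> int (r + k)"
      proof (cases "y i \<le> 0")
        case False
        then have "1 * y i \<le> int k * y i" using assms by (intro mult_right_mono) auto
        then show ?thesis using u by simp
      qed simp
      moreover have "- int (k + n) \<le> y i"
      proof (cases "y i \<ge> 0")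
        case False
        then have "int k * y i \<le> 1 * y i" using assms by (intro mult_right_mono_neg) auto
        then show ?thesis using l by simp
      qed simp
      ultimately show ?thesis by simp
    qed
    then show "y \<in> {1..k} \<rightarrow>\<^sub>E ?B"
      using y by (simp add: PiE_iff)
  qed
qed

end

theory Submission
  imports Defs
begin

text \<open>
  Write \<open>e(V, c)\<close> for the elementary symmetric polynomial of degree \<open>c\<close> in the variables indexed by
  \<open>V\<close>, and \<open>A\<^sub>b = (\<Prod>j\<noteq>b. (x\<^sub>j - t x\<^sub>b) / (x\<^sub>j - x\<^sub>b))\<close>. Both sides of the theorem, as functions
  \<open>F(V)\<close> of the set of variables, satisfy the Hall--Littlewood eigenvalue equation at \<open>q = 0\<close>
  \<open>(1 - t) (\<Sum>b\<in>V. A\<^sub>b F(V - {b})) = (1 - t\<^bsup>n-r\<^esup>) F(V)\<close>, where \<open>n = |V|\<close>,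
  which for \<open>n > r\<close> determines \<open>F(V)\<close> by induction on \<open>n\<close>; for \<open>n \<le> r\<close> degree reasons leave only
  one or no term of the determinantal sum. For the left-hand side, the equation comes from sorting
  the permutations by the variable that replaces \<open>x\<^sub>n\<close>. For the determinantal sum, column operations
  replace \<open>e(V - {b}, _)\<close> by \<open>e(V, _)\<close> in all columns but the first. The sum is then linear in the
  first column, where partial fractions give
  \<open>(1 - t) (\<Sum>b\<in>V. A\<^sub>b e(V - {b}, c)) = (1 - t\<^bsup>n-c\<^esup>) e(V, c)\<close>.
  Finally, the factor \<open>t\<^bsup>r-c\<^esup>\<close> in the first column can be omitted: rotating the columns cyclically is
  a rotation of the affine Weyl group indexing the terms, and it changes the power of \<open>t\<close> by exactly
  this factor.
\<close>

subsection \<open>Elementary symmetric polynomials\<close>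

text \<open>The generating polynomial of the elementary symmetric polynomials: identities in all
  degrees at once become polynomial identities.\<close>

definition lin_prod :: "('b \<Rightarrow> 'a::comm_ring_1) \<Rightarrow> 'b set \<Rightarrow> 'a poly" where
  "lin_prod x V = (\<Prod>i\<in>V. [:1, x i:])"

text \<open>Indexed by an arbitrary set, since single variables get removed, and by an integer
  degree, since negative degrees occur in the determinants.\<close>

definition esym :: "('b \<Rightarrow> 'a::comm_ring_1) \<Rightarrow> 'b set \<Rightarrow> int \<Rightarrow> 'a" where
  "esym x V c = (if c < 0 then 0 else coeff (lin_prod x V) (nat c))"

lemma esym_insert:
  assumes "finite V" "b \<notin> V"
  shows "esym x (insert b V) c = esym x V c + x b * esym x V (c - 1)"
proof -
  have *: "lin_prod x (insert b V) = lin_prod x V + smult (x b) (pCons 0 (lin_prod x V))"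
    using assms by (simp add: lin_prod_def)
  show ?thesis
  proof (cases "nat c")
    case 0
    then show ?thesis by (auto simp: esym_def *)
  next
    case (Suc m)
    then have "nat (c - 1) = m" "c > 0" by auto
    then show ?thesis using Suc by (simp add: esym_def *)
  qed
qed

lemma esym_empty: "esym x {} c = (if c = 0 then 1 else 0)"
  by (auto simp: esym_def lin_prod_def)

lemma esym_reindex:
  assumes "inj_on f V"
  shows "esym (x \<circ> f) V = esym x (f ` V)"
  using assms by (simp add: fun_eq_iff esym_def lin_prod_def prod.reindex)

lemma esym_eq_0:
  assumes "finite V" "c < 0 \<or> c > int (card V)"
  shows "esym x V c = 0"
  using assms by (induction V arbitrary: c) (auto simp: esym_insert esym_empty)

lemma esym_card: "finite V \<Longrightarrow> esym x V (int (card V)) = (\<Prod>i\<in>V. x i)"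
  by (induction V rule: finite_induct) (simp_all add: esym_insert esym_empty esym_eq_0)

lemma esym_0: "finite V \<Longrightarrow> esym x V 0 = 1"
  by (induction V rule: finite_induct) (simp_all add: esym_insert esym_empty esym_eq_0)

text \<open>Multiplying out the generating polynomial gives one monomial per subset, whose degree is
  the size of the subset.\<close>

lemma elem_sym_eq_esym: "elem_sym n x c = esym x {1..n} c"
proof -
  have monom_prod: "(\<Prod>i\<in>S. [:0, x i:]) = monom (\<Prod>i\<in>S. x i) (card S)" if "finite S" for S :: "nat set"
    using that by (induction S rule: finite_induct) (simp_all add: monom_Suc smult_monom)
  have "lin_prod x {1..n} = (\<Prod>i\<in>{1..n}. [:0, x i:] + 1)"
    unfolding lin_prod_def by (intro prod.cong refl) (simp add: one_pCons)
  also have "\<dots> = (\<Sum>S\<in>Pow {1..n}. monom (\<Prod>i\<in>S. x i) (card S))"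
    by (subst prod_add) (auto intro!: sum.cong simp: monom_prod finite_subset)
  finally have *: "lin_prod x {1..n} = (\<Sum>S\<in>Pow {1..n}. monom (\<Prod>i\<in>S. x i) (card S))" .
  have "coeff (lin_prod x {1..n}) m = (\<Sum>S | S \<subseteq> {1..n} \<and> card S = m. \<Prod>i\<in>S. x i)" for m
    unfolding * coeff_sum coeff_monom
    by (rule sum.mono_neutral_cong_right) auto
  then show ?thesis by (simp add: esym_def elem_sym_def)
qed

section \<open>A partial fraction identity\<close>

definition hl_coeff :: "'a::field \<Rightarrow> ('b \<Rightarrow> 'a) \<Rightarrow> 'b set \<Rightarrow> 'b \<Rightarrow> 'a" where
  "hl_coeff t x V b = (\<Prod>j\<in>V - {b}. (x j - t * x b) / (x j - x b))"

lemma degree_prod_linear_le: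
  fixes x :: "'b \<Rightarrow> 'a::comm_ring_1"
  shows "degree (\<Prod>i\<in>V. [:a, x i:]) \<le> card V"
proof (induction V rule: infinite_finite_induct)
  case (insert i V)
  have "degree ([:a, x i:] * (\<Prod>i\<in>V. [:a, x i:])) \<le> degree [:a, x i:] + degree (\<Prod>i\<in>V. [:a, x i:])"
    by (rule degree_mult_le)
  also have "\<dots> \<le> 1 + card V" using insert.IH by (intro add_mono) (auto simp: degree_pCons_le)
  finally show ?case using insert.hyps by (simp del: mult_pCons_left)
qed simp_all

text \<open>Substituting \<open>t * X\<close> for \<open>X\<close> turns \<open>t + x i * X\<close>
  into \<open>t * (1 + x i * X)\<close>. The factor \<open>t ^ c\<close> on the left avoids a
  division.\<close>

lemma coeff_prod_linear_scaled:
  fixes t :: "'a::comm_ring_1"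
  assumes "finite V"
  shows "t ^ c * coeff (\<Prod>i\<in>V. [:t, x i:]) c = t ^ card V * coeff (lin_prod x V) c"
  using assms
proof (induction V arbitrary: c rule: finite_induct)
  case empty
  then show ?case by (simp add: lin_prod_def coeff_1)
next
  case (insert b V)
  show ?case
  proof (cases c)
    case 0
    then show ?thesis using insert.hyps insert.IH[of 0] by (simp add: lin_prod_def)
  next
    case (Suc m)
    have "t ^ c * coeff (\<Prod>i\<in>insert b V. [:t, x i:]) c =
          t * (t ^ c * coeff (\<Prod>i\<in>V. [:t, x i:]) c) + t * x b * (t ^ m * coeff (\<Prod>i\<in>V. [:t, x i:]) m)"
      using insert.hyps Suc by (simp add: algebra_simps)
    also have "\<dots> = t * (t ^ card V * coeff (lin_prod x V) c) + t * x b * (t ^ card V * coeff (lin_prod x V) m)"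
      by (simp only: insert.IH)
    also have "\<dots> = t ^ card (insert b V) * coeff (lin_prod x (insert b V)) c"
      using insert.hyps Suc by (simp add: lin_prod_def algebra_simps)
    finally show ?thesis .
  qed
qed

text \<open>Both sides are polynomials of degree less than \<open>card V\<close>, so it suffices to compare them
  at the points \<open>-1 / x i\<close>, at which only one summand on the left survives.\<close>

lemma sum_hl_coeff_lin_prod:
  fixes t :: "'a::field"
  assumes V: "finite V" and inj: "inj_on x V" and nz: "\<And>i. i \<in> V \<Longrightarrow> x i \<noteq> 0"
  shows "smult (1 - t) (\<Sum>b\<in>V. smult (hl_coeff t x V b) (lin_prod x (V - {b}))) =
         lin_prod x V - (\<Prod>i\<in>V. [:t, x i:])" (is "?L = ?R")
proof (cases "V = {}")
  case True
  then show ?thesis by (simp add: lin_prod_def)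
next
  case ne: False
  \<comment> \<open>Since the coefficients in degree \<open>card V\<close> agree (both are 0),
    \<open>card V\<close> points suffice.\<close>
  show ?thesis
  proof (rule poly_eqI_degree_lead_coeff[of _ "card V" _ "(\<lambda>i. - 1 / x i) ` V"])
    have card: "card (V - {b}) < card V" if "b \<in> V" for b
      using V that by (rule card_Diff1_less)
    have dL: "degree (lin_prod x (V - {b})) < card V" if "b \<in> V" for b
      using degree_prod_linear_le[of 1 x "V - {b}"] card[OF that] by (simp add: lin_prod_def)
    have "coeff ?L (card V) = 0"
      using dL by (simp add: coeff_sum coeff_eq_0)
    moreover have "coeff (lin_prod x V) (card V) = (\<Prod>i\<in>V. x i)"
      using esym_card[OF V, of x] by (simp add: esym_def)
    moreover have "coeff (\<Prod>i\<in>V. [:t, x i:]) (card V) = (\<Prod>i\<in>V. x i)"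
      using V by (induction V rule: finite_induct)
        (simp_all add: coeff_eq_0 degree_prod_linear_le le_imp_less_Suc)
    ultimately show "coeff ?L (card V) = coeff ?R (card V)" by simp
    have "inj_on (\<lambda>i. - 1 / x i) V"
      using inj nz by (auto simp: inj_on_def field_simps)
    then show "card V \<le> card ((\<lambda>i. - 1 / x i) ` V)" by (simp add: card_image)
    show "degree ?L \<le> card V"
      by (rule order.trans[OF degree_smult_le], rule degree_sum_le[OF V],
          rule order.trans[OF degree_smult_le]) (use dL in \<open>auto intro: less_imp_le\<close>)
    show "degree ?R \<le> card V"
      unfolding lin_prod_def by (intro degree_diff_le degree_prod_linear_le)
  next
    fix z assume "z \<in> (\<lambda>i. - 1 / x i) ` V"
    then obtain i where i: "i \<in> V" and z: "z = - 1 / x i" by blast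
    have xi: "x i \<noteq> 0" using nz i by blast
    have dz: "1 + x i * z = 0" using xi z by simp
    have ev: "poly (lin_prod x W) z = (\<Prod>j\<in>W. 1 + x j * z)" for W
      by (simp add: lin_prod_def poly_prod mult.commute)
    have 0: "poly (lin_prod x W) z = 0" if "i \<in> W" "finite W" for W
      unfolding ev using that dz by (intro prod_zero) auto
    have "(\<Sum>b\<in>V. hl_coeff t x V b * poly (lin_prod x (V - {b})) z) =
          (\<Sum>b\<in>{i}. hl_coeff t x V b * poly (lin_prod x (V - {b})) z)"
      by (rule sum.mono_neutral_right) (use V i 0 in auto)
    also have "\<dots> = (\<Prod>j\<in>V - {i}. (x j - t * x i) / (x j - x i) * (1 + x j * z))"
      unfolding prod.distrib by (simp add: hl_coeff_def ev)
    also have "\<dots> = (\<Prod>j\<in>V - {i}. t + x j * z)"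
    proof (rule prod.cong[OF refl])
      fix j assume j: "j \<in> V - {i}"
      then have "x j - x i \<noteq> 0" using inj i by (auto simp: inj_on_def)
      \<comment> \<open>Here \<open>1 + x j * z = (x i - x j) / x i\<close>, which cancels the
        denominator.\<close>
      then have "(x j - t * x i) / (x j - x i) * (1 + x j * z) * x i = (t + x j * z) * x i"
        using xi by (simp add: z divide_simps) (simp add: algebra_simps)
      then show "(x j - t * x i) / (x j - x i) * (1 + x j * z) = t + x j * z"
        by (rule mult_right_cancel[THEN iffD1, OF xi])
    qed
    finally have "poly ?L z = (1 - t) * (\<Prod>j\<in>V - {i}. t + x j * z)"
      by (simp add: poly_sum)
    moreover have "poly ?R z = - (\<Prod>j\<in>V. t + x j * z)"
      using 0[OF i V] by (simp add: poly_prod mult.commute)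
    \<comment> \<open>The factor with index \<open>i\<close> is
      \<open>t + x i * z = t - 1\<close>.\<close>
    moreover have "(\<Prod>j\<in>V. t + x j * z) = (t - 1) * (\<Prod>j\<in>V - {i}. t + x j * z)"
      using V i xi by (simp add: prod.remove[of V i] z)
    ultimately show "poly ?L z = poly ?R z" by (simp only:) (simp add: algebra_simps)
  qed
qed

text \<open>Coefficient comparison in \<open>sum_hl_coeff_lin_prod\<close>. The exponent is negative
  for \<open>c > card V\<close>, hence \<open>powi\<close>.\<close>

lemma sum_hl_coeff_esym:
  fixes t :: "'a::field"
  assumes V: "finite V" and inj: "inj_on x V" and nz: "\<And>i. i \<in> V \<Longrightarrow> x i \<noteq> 0" and t: "t \<noteq> 0"
  shows "(1 - t) * (\<Sum>b\<in>V. hl_coeff t x V b * esym x (V - {b}) c) =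
         (1 - t powi (int (card V) - c)) * esym x V c"
proof (cases "c < 0")
  case True
  then show ?thesis by (simp add: esym_def)
next
  case False
  define m where "m = nat c"
  have c: "c = int m" using False by (simp add: m_def)
  have "coeff (\<Prod>i\<in>V. [:t, x i:]) m = t powi (int (card V) - c) * coeff (lin_prod x V) m"
    using coeff_prod_linear_scaled[OF V, of t m x] t by (simp add: c power_int_diff field_simps)
  moreover have "(1 - t) * (\<Sum>b\<in>V. hl_coeff t x V b * coeff (lin_prod x (V - {b})) m) =
     coeff (lin_prod x V) m - coeff (\<Prod>i\<in>V. [:t, x i:]) m"
    using arg_cong[OF sum_hl_coeff_lin_prod[OF V inj nz, of t], of "\<lambda>p. coeff p m"]
    by (simp add: coeff_sum)
  ultimately show ?thesis using False by (simp add: esym_def m_def[symmetric] algebra_simps)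
qed

subsection \<open>The symmetrization defining Hall--Littlewood polynomials\<close>

text \<open>Leaving out the factor \<open>1 / hl_v\<close> gives a recursion in the number of
  variables that is free of the normalization.\<close>

definition hl_sum :: "nat \<Rightarrow> nat list \<Rightarrow> (nat \<Rightarrow> 'a::field) \<Rightarrow> 'a \<Rightarrow> 'a" where
  "hl_sum n la x t = (\<Sum>w | w permutes {1..n}. hl_term n la (x \<circ> w) t)"

text \<open>The symmetrization uses an initial segment of indices, so the variable \<open>b\<close>
  is removed by swapping it with the last one.\<close>

lemma transpose_Suc_image:
  assumes "b \<in> {1..Suc n}"
  shows "transpose (Suc n) b ` {1..n} = {1..Suc n} - {b}"
proof -
  have "transpose (Suc n) b ` ({1..Suc n} - {Suc n}) = transpose (Suc n) b ` {1..Suc n} - transpose (Suc n) b ` {Suc n}"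
    by (rule image_set_diff[OF inj_transpose])
  moreover have "transpose (Suc n) b ` {1..Suc n} = {1..Suc n}"
    by (rule permutes_image[OF permutes_swap_id]) (use assms in auto)
  moreover have "{1..Suc n} - {Suc n} = {1..n}" by auto
  ultimately show ?thesis by simp
qed

text \<open>The last variable has exponent 0 because \<open>la\<close> has at most \<open>n\<close>
  parts; only the pairs \<open>(i, Suc n)\<close> are new.\<close>

lemma hl_term_Suc:
  assumes "length la \<le> n"
  shows "hl_term (Suc n) la z t = hl_term n la z t * (\<Prod>i=1..n. (z i - t * z (Suc n)) / (z i - z (Suc n)))"
proof -
  let ?f = "\<lambda>(i,j). (z i - t * z j) / (z i - z j)"
  let ?P = "\<lambda>n. {(i,j). 1 \<le> i \<and> i < j \<and> j \<le> (n::nat)}"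
  have fin: "finite (?P n)"
    by (rule finite_subset[of _ "{1..n} \<times> {1..n}"]) auto
  have P: "?P (Suc n) = ?P n \<union> (\<lambda>i. (i, Suc n)) ` {1..n}" by auto
  have "prod ?f (?P (Suc n)) = prod ?f (?P n) * prod ?f ((\<lambda>i. (i, Suc n)) ` {1..n})"
    unfolding P by (rule prod.union_disjoint) (use fin in auto)
  also have "prod ?f ((\<lambda>i. (i, Suc n)) ` {1..n}) = (\<Prod>i=1..n. (z i - t * z (Suc n)) / (z i - z (Suc n)))"
    by (subst prod.reindex) (auto simp: inj_on_def)
  finally have "prod ?f (?P (Suc n)) = prod ?f (?P n) * (\<Prod>i=1..n. (z i - t * z (Suc n)) / (z i - z (Suc n)))" .
  moreover have "part la (Suc n) = 0" using assms by (simp add: part_def)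
  ultimately show ?thesis by (simp add: hl_term_def)
qed

text \<open>The summand with index \<open>b\<close> collects the permutations sending \<open>n + 1\<close> to \<open>b\<close>.\<close>

lemma hl_sum_Suc:
  assumes "length la \<le> n"
  shows "hl_sum (Suc n) la x t =
    (\<Sum>b\<in>{1..Suc n}. hl_coeff t x {1..Suc n} b * hl_sum n la (x \<circ> transpose (Suc n) b) t)"
proof -
  have ins: "{1..Suc n} = insert (Suc n) {1..n}" by auto
  have "hl_sum (Suc n) la x t = (\<Sum>b\<in>{1..Suc n}. \<Sum>q | q permutes {1..n}.
          hl_term (Suc n) la (x \<circ> (transpose (Suc n) b \<circ> q)) t)"
    unfolding hl_sum_def ins by (rule sum_over_permutations_insert) auto
  also have "\<dots> = (\<Sum>b\<in>{1..Suc n}. hl_coeff t x {1..Suc n} b * hl_sum n la (x \<circ> transpose (Suc n) b) t)"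
  proof (rule sum.cong[OF refl])
    fix b assume b: "b \<in> {1..Suc n}"
    let ?y = "x \<circ> transpose (Suc n) b"
    have "hl_term (Suc n) la (x \<circ> (transpose (Suc n) b \<circ> q)) t =
          hl_coeff t x {1..Suc n} b * hl_term n la (?y \<circ> q) t" if q: "q permutes {1..n}" for q
    proof -
      have "q (Suc n) = Suc n" using permutes_not_in[OF q] by simp
      then have "hl_term (Suc n) la (?y \<circ> q) t =
        hl_term n la (?y \<circ> q) t * (\<Prod>i=1..n. (?y (q i) - t * x b) / (?y (q i) - x b))"
        using hl_term_Suc[OF assms, of "?y \<circ> q"] by simp
      \<comment> \<open>The product is symmetric in the first \<open>n\<close> variables, so it does
        not depend on \<open>q\<close>.\<close>
      also have "(\<Prod>i=1..n. (?y (q i) - t * x b) / (?y (q i) - x b)) =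
                 (\<Prod>i=1..n. (?y i - t * x b) / (?y i - x b))"
        using prod.permute[OF q, of "\<lambda>i. (?y i - t * x b) / (?y i - x b)"] by (simp add: o_def)
      also have "\<dots> = (\<Prod>j\<in>transpose (Suc n) b ` {1..n}. (x j - t * x b) / (x j - x b))"
        by (subst prod.reindex) (auto simp: o_def intro: inj_on_subset[OF inj_transpose])
      also have "\<dots> = hl_coeff t x {1..Suc n} b"
        by (simp only: transpose_Suc_image[OF b] hl_coeff_def)
      finally show ?thesis by (simp only: comp_assoc mult.commute)
    qed
    then show "(\<Sum>q | q permutes {1..n}. hl_term (Suc n) la (x \<circ> (transpose (Suc n) b \<circ> q)) t) =
       hl_coeff t x {1..Suc n} b * hl_sum n la ?y t"
      by (simp add: hl_sum_def sum_distrib_left)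
  qed
  finally show ?thesis .
qed

lemma inj_on_comp_transpose:
  assumes "b \<in> {1..Suc n}" "inj_on x {1..Suc n}"
  shows "inj_on (x \<circ> transpose (Suc n) b) {1..n}"
  by (rule comp_inj_on)
    (use assms transpose_Suc_image[OF assms(1)] in \<open>auto intro: inj_on_subset inj_on_subset[OF inj_transpose]\<close>)

text \<open>The value is the Poincare polynomial of the symmetric group. The induction step is the
  partial fraction identity in degree 0, where \<open>e(V, 0) = 1\<close>.\<close>

lemma hl_sum_Nil:
  assumes t: "t \<noteq> 0" "t \<noteq> 1"
  assumes inj: "inj_on x {1..n}" and nz: "0 \<notin> x ` {1..n}"
  shows "hl_sum n [] x t = qpoch t n / (1 - t) ^ n"
  using inj nz
proof (induction n arbitrary: x)
  case 0
  have "{(i,j). 1 \<le> i \<and> i < j \<and> j \<le> (0::nat)} = {}" by auto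
  then show ?case
    unfolding hl_sum_def hl_term_def qpoch_def by (simp only:) simp
next
  case (Suc n)
  have "hl_sum (Suc n) [] x t =
    (\<Sum>b\<in>{1..Suc n}. hl_coeff t x {1..Suc n} b * hl_sum n [] (x \<circ> transpose (Suc n) b) t)"
    by (rule hl_sum_Suc) simp
  also have "\<dots> = (\<Sum>b\<in>{1..Suc n}. hl_coeff t x {1..Suc n} b * (qpoch t n / (1 - t) ^ n))"
  proof (rule sum.cong)
    fix b assume b: "b \<in> {1..Suc n}"
    have "(x \<circ> transpose (Suc n) b) ` {1..n} \<subseteq> x ` {1..Suc n}"
      using transpose_Suc_image[OF b] by (auto simp: image_comp[symmetric])
    then have "0 \<notin> (x \<circ> transpose (Suc n) b) ` {1..n}" using Suc.prems(2) by blast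
    with inj_on_comp_transpose[OF b Suc.prems(1)]
    have "hl_sum n [] (x \<circ> transpose (Suc n) b) t = qpoch t n / (1 - t) ^ n"
      by (rule Suc.IH)
    then show "hl_coeff t x {1..Suc n} b * hl_sum n [] (x \<circ> transpose (Suc n) b) t =
      hl_coeff t x {1..Suc n} b * (qpoch t n / (1 - t) ^ n)"
      by (simp only:)
  qed simp
  also have "\<dots> = (\<Sum>b\<in>{1..Suc n}. hl_coeff t x {1..Suc n} b * esym x ({1..Suc n} - {b}) 0) * (qpoch t n / (1 - t) ^ n)"
    unfolding sum_distrib_right by (rule sum.cong) (simp_all add: esym_0)
  also have "\<dots> = (1 - t ^ Suc n) / (1 - t) * (qpoch t n / (1 - t) ^ n)"
  proof -
    have "(1 - t) * (\<Sum>b\<in>{1..Suc n}. hl_coeff t x {1..Suc n} b * esym x ({1..Suc n} - {b}) 0) =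
         (1 - t powi (int (card {1..Suc n}) - 0)) * esym x {1..Suc n} 0"
      by (rule sum_hl_coeff_esym) (use Suc.prems t in force)+
    also have "\<dots> = 1 - t ^ Suc n"
      by (simp add: esym_0 del: power_Suc of_nat_Suc)
    finally have "(\<Sum>b\<in>{1..Suc n}. hl_coeff t x {1..Suc n} b * esym x ({1..Suc n} - {b}) 0) = (1 - t ^ Suc n) / (1 - t)"
      using t by (metis eq_divide_imp mult.commute right_minus_eq)
    then show ?thesis by (simp only:)
  qed
  also have "\<dots> = qpoch t (Suc n) / (1 - t) ^ Suc n"
    by (simp add: qpoch_def mult.commute)
  finally show ?case .
qed

text \<open>With as many parts as variables, the monomial is symmetric and factors out of the
  symmetrization.\<close>

lemma hl_sum_replicate_full:
  assumes t: "t \<noteq> 0" "t \<noteq> 1"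
  assumes inj: "inj_on x {1..r}" and nz: "0 \<notin> x ` {1..r}"
  shows "hl_sum r (replicate r k) x t = (\<Prod>i=1..r. x i) ^ k * (qpoch t r / (1 - t) ^ r)"
proof -
  have "hl_term r (replicate r k) (x \<circ> w) t = (\<Prod>i=1..r. x i) ^ k * hl_term r [] (x \<circ> w) t"
    if w: "w permutes {1..r}" for w
  proof -
    have "(\<Prod>i=1..r. (x \<circ> w) i ^ part (replicate r k) i) = (\<Prod>i=1..r. (x \<circ> w) i ^ k)"
      by (rule prod.cong) (auto simp: part_def)
    also have "\<dots> = (\<Prod>i=1..r. x i ^ k)"
      using prod.permute[OF w, of "\<lambda>i. x i ^ k"] by (simp add: o_def)
    finally show ?thesis
      by (simp add: hl_term_def part_def prod_power_distrib)
  qed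
  then have "hl_sum r (replicate r k) x t = (\<Prod>i=1..r. x i) ^ k * hl_sum r [] x t"
    by (simp add: hl_sum_def sum_distrib_left)
  then show ?thesis by (simp only: hl_sum_Nil[OF t inj nz])
qed

lemma hl_v_replicate:
  "hl_v n (replicate r k) t =
     qpoch t (n - r) / (1 - t) ^ (n - r) * (qpoch t r / (1 - t) ^ r)"
proof -
  have "count_list (replicate r k) k = r" by (induction r) simp_all
  moreover have "set (replicate r k) = (if r = 0 then {} else {k})" by auto
  ultimately show ?thesis by (simp add: hl_v_def qpoch_def)
qed

subsection \<open>Leibniz expansion of the determinants\<close>

text \<open>The bijection restricts to the supports: either both are finite, or both sums take the
  default value 0.\<close>

lemma sum'_reindex_bij_betw:
  assumes "bij_betw h S T"
  shows "sum' (\<lambda>x. g (h x)) S = sum' g T"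
proof -
  have b: "bij_betw h {x \<in> S. g (h x) \<noteq> 0} {y \<in> T. g y \<noteq> 0}"
    using assms by (auto simp: bij_betw_def inj_on_def)
  show ?thesis
    using sum.reindex_bij_betw[OF b, of g] bij_betw_finite[OF b] by (simp add: sum.G_def)
qed

lemma sign_conj:
  assumes "permutation c" "permutation u"
  shows "sign (c \<circ> u \<circ> Hilbert_Choice.inv c) = sign u"
  using assms by (simp add: sign_compose permutation_compose permutation_inverse sign_inverse mult.commute sign_idempotent)

lemma permutes_conj:
  assumes c: "c permutes U" and u: "u permutes S"
  shows "c \<circ> u \<circ> Hilbert_Choice.inv c permutes c ` S"
proof -
  have bij: "bij c" using c by (rule permutes_bij)
  show ?thesis
    unfolding permutes_def bij_iff[symmetric]
  proof (intro conjI allI impI)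
    show "bij (c \<circ> u \<circ> Hilbert_Choice.inv c)"
      using bij permutes_bij[OF u] by (intro bij_comp bij_imp_bij_inv)
    fix a assume "a \<notin> c ` S"
    then have "Hilbert_Choice.inv c a \<notin> S" using bij by (metis bij_inv_eq_iff imageI)
    then show "(c \<circ> u \<circ> Hilbert_Choice.inv c) a = a"
      using permutes_not_in[OF u] bij by (simp add: bij_is_surj surj_f_inv_f)
  qed
qed

text \<open>Serves to shift the index range \<open>{0..<k}\<close> of matrices to
  \<open>{1..k}\<close>.\<close>

lemma sum_permutes_conj:
  assumes c: "c permutes U"
  shows "(\<Sum>u | u permutes c ` S. f u) = (\<Sum>u | u permutes S. f (c \<circ> u \<circ> Hilbert_Choice.inv c))"
proof (rule sum.reindex_bij_witness[of _ "\<lambda>u. c \<circ> u \<circ> Hilbert_Choice.inv c" "\<lambda>u. Hilbert_Choice.inv c \<circ> u \<circ> c"])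
  have bij: "bij c" using c by (rule permutes_bij)
  have i: "Hilbert_Choice.inv (Hilbert_Choice.inv c) = c" using bij by (rule inv_inv_eq)
  have 1: "c (Hilbert_Choice.inv c a) = a" "Hilbert_Choice.inv c (c a) = a" for a
    using bij by (simp_all add: bij_is_surj surj_f_inv_f bij_is_inj)
  { fix u assume u: "u \<in> {u. u permutes c ` S}"
    show "c \<circ> (Hilbert_Choice.inv c \<circ> u \<circ> c) \<circ> Hilbert_Choice.inv c = u" by (simp add: fun_eq_iff 1)
    then show "f (c \<circ> (Hilbert_Choice.inv c \<circ> u \<circ> c) \<circ> Hilbert_Choice.inv c) = f u" by simp
    have "Hilbert_Choice.inv c ` c ` S = S" using 1 by (simp add: image_comp comp_def)
    then show "Hilbert_Choice.inv c \<circ> u \<circ> c \<in> {u. u permutes S}"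
      using permutes_conj[OF permutes_inv[OF c], of u "c ` S"] u by (simp add: i) }
  { fix u assume u: "u \<in> {u. u permutes S}"
    show "Hilbert_Choice.inv c \<circ> (c \<circ> u \<circ> Hilbert_Choice.inv c) \<circ> c = u" by (simp add: fun_eq_iff 1)
    show "c \<circ> u \<circ> Hilbert_Choice.inv c \<in> {u. u permutes c ` S}"
      using permutes_conj[OF c] u by simp }
qed

lemma det1_eq_sum:
  "det1 k A = (\<Sum>u | u permutes {1..k}. of_int (sign u) * (\<Prod>j=1..k. A (u j) j))"
proof -
  \<comment> \<open>Conjugation needs a permutation, so the shift \<open>i \<mapsto> i + 1\<close>
    on \<open>{0..<k}\<close> is completed by \<open>k \<mapsto> 0\<close>.\<close>
  define c where "c = (\<lambda>i. if i < k then Suc i else if i = k then 0 else i)"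
  have c: "c permutes {0..k}"
  proof (rule bij_imp_permutes)
    show "bij_betw c {0..k} {0..k}"
      by (rule bij_betw_byWitness[of _ "\<lambda>i. if i = 0 then k else i - 1"]) (auto simp: c_def)
  qed (auto simp: c_def)
  have img: "c ` {0..<k} = {1..k}"
  proof -
    have "c ` {0..<k} = Suc ` {0..<k}" by (rule image_cong) (auto simp: c_def)
    then show ?thesis by (simp add: image_Suc_atLeastLessThan atLeastLessThanSuc_atLeastAtMost)
  qed
  have "det1 k A = (\<Sum>p | p permutes {0..<k}. of_int (sign p) * (\<Prod>j<k. mat k k (\<lambda>(i,j). A (i + 1) (j + 1)) $$ (p j, j)))"
    unfolding det1_def by (rule det_col) simp
  also have "\<dots> = (\<Sum>p | p permutes {0..<k}. of_int (sign (c \<circ> p \<circ> Hilbert_Choice.inv c)) * (\<Prod>j=1..k. A ((c \<circ> p \<circ> Hilbert_Choice.inv c) j) j))"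
  proof (rule sum.cong[OF refl])
    fix p assume "p \<in> {p. p permutes {0..<k}}"
    then have p: "p permutes {0..<k}" by simp
    have "sign (c \<circ> p \<circ> Hilbert_Choice.inv c) = sign p"
      using c p by (intro sign_conj) (auto intro: permutes_imp_permutation[rotated])
    moreover have "(\<Prod>j<k. mat k k (\<lambda>(i,j). A (i + 1) (j + 1)) $$ (p j, j)) = (\<Prod>j=1..k. A ((c \<circ> p \<circ> Hilbert_Choice.inv c) j) j)"
      unfolding One_nat_def prod.atLeast1_atMost_eq
    proof (rule prod.cong[OF refl])
      fix j assume j: "j \<in> {..<k}"
      then have pj: "p j < k" using permutes_in_image[OF p, of j] by simp
      have "Hilbert_Choice.inv c (Suc j) = j"
        using j inv_f_f[OF permutes_inj[OF c], of j] by (simp add: c_def)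
      then show "mat k k (\<lambda>(i,j). A (i + Suc 0) (j + Suc 0)) $$ (p j, j) = A ((c \<circ> p \<circ> Hilbert_Choice.inv c) (Suc j)) (Suc j)"
        using j pj by (simp add: c_def)
    qed
    ultimately show "of_int (sign p) * (\<Prod>j<k. mat k k (\<lambda>(i,j). A (i + 1) (j + 1)) $$ (p j, j)) =
      of_int (sign (c \<circ> p \<circ> Hilbert_Choice.inv c)) * (\<Prod>j=1..k. A ((c \<circ> p \<circ> Hilbert_Choice.inv c) j) j)" by simp
  qed
  also have "\<dots> = (\<Sum>u | u permutes {1..k}. of_int (sign u) * (\<Prod>j=1..k. A (u j) j))"
    using sum_permutes_conj[OF c, of "\<lambda>u. of_int (sign u) * (\<Prod>j=1..k. A (u j) j)" "{0..<k}"]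
    by (simp only: img)
  finally show ?thesis .
qed

definition tuples :: "nat \<Rightarrow> (nat \<Rightarrow> int) set" where
  "tuples k = {y \<in> {1..k} \<rightarrow>\<^sub>E UNIV. (\<Sum>i=1..k. y i) = 0}"

definition weight :: "nat \<Rightarrow> nat \<Rightarrow> int \<Rightarrow> int" where
  "weight k i y = int k * ((y * (y - 1)) div 2) + int i * y"

text \<open>The degree occurring in column \<open>j\<close> of the Leibniz term of \<open>u\<close>,
  where the row is \<open>u j\<close>.\<close>

definition index :: "nat \<Rightarrow> nat \<Rightarrow> (nat \<Rightarrow> nat) \<Rightarrow> (nat \<Rightarrow> int) \<Rightarrow> nat \<Rightarrow> int" where
  "index k r u y j = int r - int (u j) + int j - int k * y (u j)"

text \<open>A term of the Leibniz expansion of the determinants, the first column being built from \<open>g\<close>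
  and the others from \<open>e\<close>.\<close>

definition affine_term ::
    "'a::field \<Rightarrow> nat \<Rightarrow> nat \<Rightarrow> (int \<Rightarrow> 'a) \<Rightarrow> (int \<Rightarrow> 'a) \<Rightarrow> (nat \<Rightarrow> nat) \<times> (nat \<Rightarrow> int) \<Rightarrow> 'a" where
  "affine_term t k r g e = (\<lambda>(u, y). of_int (sign u) * t powi (\<Sum>i=1..k. weight k i (y i)) *
     (g (index k r u y 1) * (\<Prod>j=2..k. e (index k r u y j))))"

lemma powi_sum:
  fixes t :: "'a::field"
  assumes "t \<noteq> 0"
  shows "t powi (\<Sum>i\<in>A. f i) = (\<Prod>i\<in>A. t powi f i)"
  by (induction A rule: infinite_finite_induct) (use assms in \<open>simp_all add: power_int_add\<close>)

lemma prod_first: "k > 0 \<Longrightarrow> (\<Prod>j=1..k. f j) = f 1 * (\<Prod>j=2..k. f (j::nat))"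
  by (subst prod.atLeast_Suc_atMost) (auto simp: numeral_2_eq_2)

text \<open>The powers of \<open>t\<close> depend only on the row, so their product is the same for
  every \<open>u\<close>.\<close>

lemma det1_eq_sum_affine_term:
  fixes t :: "'a::field"
  assumes "t \<noteq> 0" "k > 0"
  shows "det1 k (\<lambda>i j. t powi weight k i (y i) *
           (if j = 1 then g else e) (int r - int i + int j - int k * y i)) =
         (\<Sum>u | u permutes {1..k}. affine_term t k r g e (u, y))"
  unfolding det1_eq_sum
proof (rule sum.cong[OF refl])
  fix u assume "u \<in> {u. u permutes {1..k}}"
  then have u: "u permutes {1..k}" by simp
  have "(\<Prod>j=1..k. t powi weight k (u j) (y (u j))) = t powi (\<Sum>i=1..k. weight k i (y i))"
    using prod.permute[OF u, of "\<lambda>i. t powi weight k i (y i)"] assms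
    by (simp add: powi_sum o_def)
  moreover have "(\<Prod>j=1..k. (if j = 1 then g else e) (index k r u y j)) =
     g (index k r u y 1) * (\<Prod>j=2..k. e (index k r u y j))"
    unfolding prod_first[OF assms(2)] by simp
  ultimately show "of_int (sign u) * (\<Prod>j=1..k. t powi weight k (u j) (y (u j)) *
           (if j = 1 then g else e) (int r - int (u j) + int j - int k * y (u j))) =
         affine_term t k r g e (u, y)"
    unfolding prod.distrib affine_term_def prod.case index_def[symmetric] by (simp only: mult.assoc)
qed

text \<open>When all columns come from \<open>e'\<close>, adding \<open>z\<close> times each column to its right neighbour turns
  \<open>e'\<close> into \<open>e\<close> in every column but the first.\<close>

lemma sum_affine_term_column:
  fixes t :: "'a::field"
  assumes t: "t \<noteq> 0" and k: "k > 0" and e: "\<And>c. e c = e' c + z * e' (c - 1)"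
  shows "(\<Sum>u | u permutes {1..k}. affine_term t k r e' e (u, y)) =
         (\<Sum>u | u permutes {1..k}. affine_term t k r e' e' (u, y))"
proof -
  define M where "M = (\<lambda>g. mat k k (\<lambda>(i, j). t powi weight k (i + 1) (y (i + 1)) *
           (if j + 1 = 1 then e' else g) (int r - int (i + 1) + int (j + 1) - int k * y (i + 1))))"
  \<comment> \<open>Unit upper triangular, hence of determinant 1. The left neighbour of a column
    has degrees one lower, as the recursion for \<open>e\<close> requires.\<close>
  define U where "U = mat k k (\<lambda>(i, j). if i = j then 1 else if Suc i = j then z else 0 :: 'a)"
  have "M e = M e' * U"
  proof (rule eq_matI)
    fix i j assume ij: "i < dim_row (M e' * U)" "j < dim_col (M e' * U)"
    then have i: "i < k" and j: "j < k" by (simp_all add: M_def U_def)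
    have "(M e' * U) $$ (i, j) = (\<Sum>l=0..<k. M e' $$ (i, l) * U $$ (l, j))"
      using i j by (simp add: M_def U_def scalar_prod_def)
    also have "\<dots> = M e $$ (i, j)"
    proof (cases j)
      case 0
      have "(\<Sum>l=0..<k. M e' $$ (i, l) * U $$ (l, j)) = (\<Sum>l\<in>{0}. M e' $$ (i, l) * U $$ (l, j))"
        by (rule sum.mono_neutral_right) (use k j in \<open>auto simp: U_def 0\<close>)
      then show ?thesis using k i by (simp add: U_def M_def 0)
    next
      case (Suc m)
      have "(\<Sum>l=0..<k. M e' $$ (i, l) * U $$ (l, j)) = (\<Sum>l\<in>{m, j}. M e' $$ (i, l) * U $$ (l, j))"
        by (rule sum.mono_neutral_right) (use k j in \<open>auto simp: U_def Suc\<close>)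
      also have "\<dots> = M e' $$ (i, m) * z + M e' $$ (i, j)"
        using j by (simp add: U_def Suc)
      also have "\<dots> = M e $$ (i, j)"
      proof -
        have j0: "j \<noteq> 0" using Suc by simp
        define c where "c = int r - int (i + 1) + int (j + 1) - int k * y (i + 1)"
        have "int r - int (i + 1) + int (m + 1) - int k * y (i + 1) = c - 1"
          by (simp add: c_def Suc)
        then have "M e' $$ (i, m) = t powi weight k (i + 1) (y (i + 1)) * e' (c - 1)"
          using i j Suc by (auto simp: M_def simp del: of_nat_add)
        moreover have "M e' $$ (i, j) = t powi weight k (i + 1) (y (i + 1)) * e' c"
          "M e $$ (i, j) = t powi weight k (i + 1) (y (i + 1)) * e c"
          using i j j0 by (simp_all add: M_def c_def)
        ultimately show ?thesis by (simp add: e[of c] algebra_simps)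
      qed
      finally show ?thesis .
    qed
    finally show "M e $$ (i, j) = (M e' * U) $$ (i, j)" by simp
  qed (simp_all add: M_def U_def)
  moreover have "det U = 1"
    by (subst det_upper_triangular[of _ k]) (auto simp: U_def prod_list_diag_prod)
  ultimately have "det (M e) = det (M e')"
    using det_mult[of "M e'" k U] by (simp add: M_def U_def)
  then show ?thesis
    unfolding det1_eq_sum_affine_term[OF t k, symmetric] det1_def M_def .
qed

subsection \<open>Cyclic rotation of the columns\<close>

definition rot :: "nat \<Rightarrow> nat \<Rightarrow> nat" where
  "rot k j = (if j = k then 1 else if 1 \<le> j \<and> j < k then j + 1 else j)"

lemma rot_permutes:
  assumes "k > 0" shows "rot k permutes {1..k}"
proof (rule bij_imp_permutes)
  show "bij_betw (rot k) {1..k} {1..k}"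
    by (rule bij_betw_byWitness[of _ "\<lambda>i. if i = 1 then k else i - 1"])
      (use assms in \<open>auto simp: rot_def\<close>)
qed (use assms in \<open>auto simp: rot_def\<close>)

lemma int_rot:
  assumes "a \<in> {1..k}"
  shows "int (rot k a) = int a + 1 - (if a = k then int k else 0)"
  using assms by (auto simp: rot_def)

text \<open>The correction of \<open>y\<close> is the one that makes the map cyclically permute the values
  \<open>r - u j + j - k * y (u j)\<close>, see \<open>rotate_pair_index\<close> below.\<close>

definition rotate_pair ::
    "nat \<Rightarrow> (nat \<Rightarrow> nat) \<times> (nat \<Rightarrow> int) \<Rightarrow> (nat \<Rightarrow> nat) \<times> (nat \<Rightarrow> int)" where
  "rotate_pair k = (\<lambda>(u, y). (Hilbert_Choice.inv (rot k) \<circ> u \<circ> rot k,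
     \<lambda>a\<in>{1..k}. y (rot k a) - of_bool (a = k) + of_bool (rot k a = u 1)))"

lemma triangle_Suc: "((y + 1) * y) div 2 = (y * (y - 1)) div 2 + (y::int)"
proof -
  have "(y + 1) * y = y * (y - 1) + y * 2" by (simp add: algebra_simps)
  then show ?thesis by simp
qed

lemma weight_Suc: "weight k i (y + 1) = weight k i y + int k * y + int i"
  using triangle_Suc[of y] by (simp add: weight_def algebra_simps)

text \<open>Wrapping around from row \<open>k\<close> to row 1 is compensated by lowering
  \<open>y\<close> by one, by the recursion for triangular numbers.\<close>

lemma weight_rot:
  assumes "a \<in> {1..k}"
  shows "weight k a (y - of_bool (a = k)) = weight k (rot k a) y - y"
proof (cases "a = k")
  case True
  then show ?thesis
    using weight_Suc[of k 1 "y - 1"] assms by (simp add: weight_def rot_def algebra_simps)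
next
  case False
  then show ?thesis using assms by (simp add: weight_def rot_def algebra_simps)
qed

text \<open>Conjugation by \<open>rot k\<close> keeps the sign, and the two corrections of
  \<open>y\<close> cancel in its sum. By \<open>weight_rot\<close> the first one leaves the total
  weight unchanged, as the entries of \<open>y\<close> sum to 0; the second one adds
  \<open>k * y (u 1) + u 1 - 1\<close>, which is \<open>r - index k r u y 1\<close>.\<close>

lemma rotate_pair_props:
  assumes k: "k > 0" and u: "u permutes {1..k}" and y: "y \<in> tuples k" and p: "rotate_pair k (u, y) = (u', y')"
  shows rotate_pair_permutes: "u' permutes {1..k}"
    and rotate_pair_sign: "sign u' = sign u"
    and rotate_pair_tuples: "y' \<in> tuples k"
    and rotate_pair_weight: "(\<Sum>i=1..k. weight k i (y' i)) = (\<Sum>i=1..k. weight k i (y i)) + int r - index k r u y 1"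
    and rotate_pair_index: "j \<in> {1..k} \<Longrightarrow> index k r u' y' j = index k r u y (rot k j)"
proof -
  let ?s = "rot k"
  have s: "?s permutes {1..k}" by (rule rot_permutes[OF k])
  have si: "?s (Hilbert_Choice.inv ?s a) = a" for a
    using s by (rule permutes_inverses)
  have u': "u' = Hilbert_Choice.inv ?s \<circ> u \<circ> ?s"
    and y': "y' = (\<lambda>a\<in>{1..k}. y (?s a) - of_bool (a = k) + of_bool (?s a = u 1))"
    using p by (simp_all add: rotate_pair_def)
  show pu': "u' permutes {1..k}"
    unfolding u' by (intro permutes_compose permutes_inv s u)
  show "sign u' = sign u"
    unfolding u' using s u
    by (simp add: sign_compose permutes_imp_permutation[of "{1..k}"] permutes_inv permutation_compose
        permutation_inverse sign_inverse sign_idempotent mult.commute)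
  have sumy: "(\<Sum>i=1..k. y i) = 0" using y by (simp add: tuples_def)
  have inj: "?s a = ?s b \<longleftrightarrow> a = b" for a b
    using permutes_inj[OF s] by (simp add: inj_eq)
  have u1: "u 1 \<in> {1..k}" using permutes_in_image[OF u, of 1] k by simp
  have perm: "(\<Sum>i=1..k. f (?s i)) = (\<Sum>i=1..k. f i)" for f :: "nat \<Rightarrow> int"
    using sum.permute[OF s, of f] by (simp add: o_def)
  have "(\<Sum>i=1..k. y' i) = (\<Sum>i=1..k. y (?s i)) - (\<Sum>i=1..k. of_bool (i = k)) + (\<Sum>i=1..k. of_bool (?s i = u 1))"
    unfolding y' by (simp add: sum.distrib sum_subtractf)
  also have "\<dots> = 0"
    unfolding perm perm[of "\<lambda>i. of_bool (i = u 1)"] using k u1 sumy by simp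
  finally show "y' \<in> tuples k"
    by (simp add: tuples_def y')
  have "weight k a (y' a) = (weight k (?s a) (y (?s a)) - y (?s a)) +
     (if ?s a = u 1 then int k * y (u 1) + int (u 1) - 1 else 0)" if a: "a \<in> {1..k}" for a
  proof (cases "?s a = u 1")
    case False
    then show ?thesis using a weight_rot[OF a] by (simp add: y')
  next
    case True
    have "weight k a (y' a) = weight k a (y (?s a) - of_bool (a = k) + 1)"
      using a True by (simp add: y')
    also have "\<dots> = weight k (?s a) (y (?s a)) - y (?s a) + int k * (y (?s a) - of_bool (a = k)) + int a"
      unfolding weight_Suc weight_rot[OF a] ..
    moreover have "int k * (y (?s a) - of_bool (a = k)) + int a = int k * y (?s a) + int (?s a) - 1"
      using a by (simp add: int_rot algebra_simps)
    ultimately show ?thesis using True by simp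
  qed
  then have "(\<Sum>i=1..k. weight k i (y' i)) = (\<Sum>i=1..k. (weight k (?s i) (y (?s i)) - y (?s i)) +
     (if ?s i = u 1 then int k * y (u 1) + int (u 1) - 1 else 0))"
    by (rule sum.cong[OF refl])
  also have "\<dots> = (\<Sum>i=1..k. (weight k i (y i) - y i) +
     (if i = u 1 then int k * y (u 1) + int (u 1) - 1 else 0))"
    by (rule perm)
  also have "\<dots> = (\<Sum>i=1..k. weight k i (y i)) + (int k * y (u 1) + int (u 1) - 1)"
    using u1 sumy by (simp add: sum.distrib sum_subtractf)
  finally show "(\<Sum>i=1..k. weight k i (y' i)) = (\<Sum>i=1..k. weight k i (y i)) + int r - index k r u y 1"
    by (simp add: index_def)
  assume j: "j \<in> {1..k}"
  have u'j: "u' j \<in> {1..k}" using permutes_in_image[OF pu'] j by blast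
  have su: "?s (u' j) = u (?s j)" by (simp add: u' si)
  have sj: "u (?s j) = u 1 \<longleftrightarrow> j = k"
    using permutes_inj[OF u] inj[of j k] by (simp add: inj_eq rot_def)
  have y'u: "y' (u' j) = y (u (?s j)) - of_bool (u' j = k) + of_bool (j = k)"
    using u'j su sj by (simp add: y')
  \<comment> \<open>A wrap of the row (\<open>u' j = k\<close>) and one of the column
    (\<open>j = k\<close>) each shift the degree by \<open>k\<close>; the two corrections of
    \<open>y\<close> undo this.\<close>
  show "index k r u' y' j = index k r u y (?s j)"
    using int_rot[OF u'j] int_rot[OF j] by (simp add: index_def y'u su algebra_simps split: if_splits)
qed

text \<open>The rotation only permutes the degrees among the columns, so the product of the values
  of \<open>e\<close> is unchanged; the change of weight is the extra factor in the first
  column.\<close>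

lemma affine_term_rotate_pair:
  fixes t :: "'a::field"
  assumes t: "t \<noteq> 0" and k: "k > 0" and u: "u permutes {1..k}" and y: "y \<in> tuples k"
  shows "affine_term t k r e e (rotate_pair k (u, y)) =
         affine_term t k r (\<lambda>c. t powi (int r - c) * e c) e (u, y)"
proof -
  obtain u' y' where p: "rotate_pair k (u, y) = (u', y')" by fastforce
  note P = rotate_pair_props[OF k u y p]
  have "(\<Prod>j=1..k. e (index k r u' y' j)) = (\<Prod>j=1..k. e (index k r u y (rot k j)))"
    by (rule prod.cong) (simp_all add: P(5))
  also have "\<dots> = (\<Prod>j=1..k. e (index k r u y j))"
    using prod.permute[OF rot_permutes[OF k], of "\<lambda>j. e (index k r u y j)"] by (simp add: o_def)
  finally have 1: "e (index k r u' y' 1) * (\<Prod>j=2..k. e (index k r u' y' j)) =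
      e (index k r u y 1) * (\<Prod>j=2..k. e (index k r u y j))"
    by (simp only: prod_first[OF k])
  have 2: "t powi (\<Sum>i=1..k. weight k i (y' i)) =
      t powi (\<Sum>i=1..k. weight k i (y i)) * t powi (int r - index k r u y 1)"
    unfolding P(4)[of r] add_diff_eq[symmetric] by (rule power_int_add) (simp add: t)
  show ?thesis
    unfolding p affine_term_def prod.case 1 2 P(2) by (simp only: mult_ac)
qed

lemma bij_betw_rotate_pair:
  assumes k: "k > 0"
  shows "bij_betw (rotate_pair k) ({u. u permutes {1..k}} \<times> tuples k) ({u. u permutes {1..k}} \<times> tuples k)"
proof -
  let ?s = "rot k"
  let ?i = "Hilbert_Choice.inv ?s"
  let ?P = "{u. u permutes {1..k}} \<times> tuples k"
  have s: "?s permutes {1..k}" by (rule rot_permutes[OF k])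
  have i: "?i permutes {1..k}" using s by (rule permutes_inv)
  have si: "?s (?i a) = a" "?i (?s a) = a" for a
    using permutes_inverses[OF s] by auto
  have in_s: "?s a \<in> {1..k} \<longleftrightarrow> a \<in> {1..k}" "?i a \<in> {1..k} \<longleftrightarrow> a \<in> {1..k}" for a
    using permutes_in_image[OF s] permutes_in_image[OF i] by blast+
  have s1: "?s k = 1" by (simp add: rot_def)
  \<comment> \<open>The inverse map. Since \<open>rot k k = 1\<close>, the old value
    \<open>u 1\<close> is recovered from the rotated permutation by applying \<open>rot k\<close> to
    its value at \<open>k\<close>.\<close>
  define h where "h = (\<lambda>(u :: nat \<Rightarrow> nat, y :: nat \<Rightarrow> int). (?s \<circ> u \<circ> ?i,
     \<lambda>a\<in>{1..k}. y (?i a) + of_bool (?i a = k) - of_bool (a = ?s (u k))))"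
  have i1: "?i 1 = k" using si(2)[of k] by (simp add: s1)
  show ?thesis
  proof (rule bij_betw_byWitness[of _ h])
    show "\<forall>p\<in>?P. h (rotate_pair k p) = p"
    proof clarify
      fix u y assume u: "u permutes {1..k}" and y: "y \<in> tuples k"
      have "h (rotate_pair k (u, y)) = (u, \<lambda>a\<in>{1..k}. y a)"
        unfolding h_def rotate_pair_def prod.case prod.inject
        by (intro conjI ext) (simp_all only: restrict_apply in_s si s1 o_apply, simp)
      also have "(\<lambda>a\<in>{1..k}. y a) = y"
        using y by (auto simp: tuples_def PiE_def extensional_restrict)
      finally show "h (rotate_pair k (u, y)) = (u, y)" .
    qed
    show "\<forall>p\<in>?P. rotate_pair k (h p) = p"
    proof clarify
      fix u y assume u: "u permutes {1..k}" and y: "y \<in> tuples k"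
      have "rotate_pair k (h (u, y)) = (u, \<lambda>a\<in>{1..k}. y a)"
        unfolding h_def rotate_pair_def prod.case prod.inject
        by (intro conjI ext) (simp_all only: restrict_apply in_s si i1 o_apply, simp)
      also have "(\<lambda>a\<in>{1..k}. y a) = y"
        using y by (auto simp: tuples_def PiE_def extensional_restrict)
      finally show "rotate_pair k (h (u, y)) = (u, y)" .
    qed
    show "rotate_pair k ` ?P \<subseteq> ?P"
    proof (rule image_subsetI)
      fix p assume "p \<in> ?P"
      then obtain u y where p: "p = (u, y)" and u: "u permutes {1..k}" and y: "y \<in> tuples k" by blast
      obtain u' y' where q: "rotate_pair k (u, y) = (u', y')" by fastforce
      show "rotate_pair k p \<in> ?P"
        using rotate_pair_permutes[OF k u y q] rotate_pair_tuples[OF k u y q] by (simp add: p q)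
    qed
    show "h ` ?P \<subseteq> ?P"
    proof (rule image_subsetI)
      fix p assume "p \<in> ?P"
      then obtain u y where p: "p = (u, y)" and u: "u permutes {1..k}" and y: "y \<in> tuples k" by blast
      define u' where u': "u' = ?s \<circ> u \<circ> ?i"
      define y' where y': "y' = (\<lambda>a\<in>{1..k}. y (?i a) + of_bool (?i a = k) - of_bool (a = ?s (u k)))"
      have h: "h p = (u', y')" by (simp only: p h_def u' y' prod.case)
      have "u' permutes {1..k}"
        unfolding u' by (intro permutes_compose s i u)
      have perm: "(\<Sum>a=1..k. f (?i a)) = (\<Sum>a=1..k. f a)" for f :: "nat \<Rightarrow> int"
        using sum.permute[OF i, of f] by (simp add: o_def)
      have suk: "?s (u k) \<in> {1..k}" using in_s permutes_in_image[OF u, of k] k by simp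
      have "(\<Sum>a=1..k. y' a) = (\<Sum>a=1..k. y (?i a)) + (\<Sum>a=1..k. of_bool (?i a = k)) - (\<Sum>a=1..k. of_bool (a = ?s (u k)))"
        unfolding y' by (simp add: sum.distrib sum_subtractf)
      also have "\<dots> = 0"
        unfolding perm perm[of "\<lambda>a. of_bool (a = k)"] using suk y k by (simp add: tuples_def)
      finally have "y' \<in> tuples k" by (simp add: tuples_def y')
      with \<open>u' permutes {1..k}\<close> show "h p \<in> ?P" by (simp add: h)
    qed
  qed
qed

text \<open>The rotation also moves \<open>y\<close>, so the identity concerns the whole sum and not
  single determinants.\<close>

lemma sum'_affine_term_rotate:
  fixes t :: "'a::field"
  assumes t: "t \<noteq> 0" and k: "k > 0"
  shows "sum' (affine_term t k r (\<lambda>c. t powi (int r - c) * e c) e) ({u. u permutes {1..k}} \<times> tuples k) =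
         sum' (affine_term t k r e e) ({u. u permutes {1..k}} \<times> tuples k)"
proof -
  have "sum' (affine_term t k r (\<lambda>c. t powi (int r - c) * e c) e) ({u. u permutes {1..k}} \<times> tuples k) =
        sum' (\<lambda>p. affine_term t k r e e (rotate_pair k p)) ({u. u permutes {1..k}} \<times> tuples k)"
    by (rule sum.cong') (auto simp: affine_term_rotate_pair[OF t k])
  also have "\<dots> = sum' (affine_term t k r e e) ({u. u permutes {1..k}} \<times> tuples k)"
    by (rule sum'_reindex_bij_betw[OF bij_betw_rotate_pair[OF k]])
  finally show ?thesis .
qed

subsection \<open>The eigenvalue equation for the determinantal sum\<close>

text \<open>A finite range that contains the support, on which the sums are linear and can be
  interchanged.\<close>

definition tuples_box :: "nat \<Rightarrow> nat \<Rightarrow> (nat \<Rightarrow> int) set" where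
  "tuples_box k M = tuples k \<inter> ({1..k} \<rightarrow>\<^sub>E {- int M..int M})"

lemma finite_tuples_box: "finite (tuples_box k M)"
  unfolding tuples_box_def by (intro finite_Int disjI2 finite_PiE) auto

lemma affine_term_neq_0:
  assumes nz: "affine_term t k r g e (u, y) \<noteq> 0"
    and g: "\<And>c. c < 0 \<or> c > int N \<Longrightarrow> g c = 0" and e: "\<And>c. c < 0 \<or> c > int N \<Longrightarrow> e c = 0"
    and j: "j \<in> {1..k}"
  shows "index k r u y j \<in> {0..int N}"
proof (rule ccontr)
  assume "\<not> ?thesis"
  then have 0: "index k r u y j < 0 \<or> index k r u y j > int N" by auto
  have "g (index k r u y 1) * (\<Prod>j=2..k. e (index k r u y j)) = 0"
  proof (cases "j = 1")
    case True
    then show ?thesis using g[OF 0] by simp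
  next
    case False
    then have "(\<Prod>j=2..k. e (index k r u y j)) = 0"
      using j e[OF 0] by (intro prod_zero) auto
    then show ?thesis by simp
  qed
  then show False using nz by (simp add: affine_term_def)
qed

text \<open>A nonzero term has all its degrees in \<open>{0..N}\<close>, which bounds
  \<open>k * y i\<close> and hence \<open>y i\<close>.\<close>

lemma affine_term_outside_box:
  assumes k: "k > 0" and u: "u permutes {1..k}" and y: "y \<in> tuples k - tuples_box k (r + k + N)"
    and g: "\<And>c. c < 0 \<or> c > int N \<Longrightarrow> g c = 0" and e: "\<And>c. c < 0 \<or> c > int N \<Longrightarrow> e c = 0"
  shows "affine_term t k r g e (u, y) = 0"
proof (rule ccontr)
  assume nz: "affine_term t k r g e (u, y) \<noteq> 0"
  let ?M = "int (r + k + N)"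
  have "y i \<in> {- ?M..?M}" if i: "i \<in> {1..k}" for i
  proof -
    obtain j where j: "j \<in> {1..k}" and uj: "u j = i"
      using permutes_image[OF u] i by (metis imageE)
    have idx: "0 \<le> int r - int i + int j - int k * y i" "int r - int i + int j - int k * y i \<le> int N"
      using affine_term_neq_0[OF nz g e j] by (simp_all add: index_def uj)
    have 1: "\<bar>y i\<bar> \<le> \<bar>int k * y i\<bar>" using k by (simp add: abs_mult mult_le_cancel_right1)
    have "\<bar>int k * y i\<bar> \<le> ?M" using idx i j by auto
    with 1 show ?thesis by auto
  qed
  then have "y \<in> tuples_box k (r + k + N)"
    using y by (auto simp: tuples_box_def tuples_def PiE_iff)
  with y show False by simp
qed

text \<open>The sum over \<open>u\<close> is put inside because column operations apply for fixed
  \<open>y\<close>.\<close>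

lemma sum'_affine_term:
  assumes k: "k > 0"
    and g: "\<And>c. c < 0 \<or> c > int N \<Longrightarrow> g c = 0" and e: "\<And>c. c < 0 \<or> c > int N \<Longrightarrow> e c = 0"
  shows "sum' (affine_term t k r g e) ({u. u permutes {1..k}} \<times> tuples k) =
         (\<Sum>y\<in>tuples_box k (r + k + N). \<Sum>u | u permutes {1..k}. affine_term t k r g e (u, y))"
proof -
  let ?B = "tuples_box k (r + k + N)"
  have "sum' (affine_term t k r g e) ({u. u permutes {1..k}} \<times> tuples k) =
        sum' (affine_term t k r g e) ({u. u permutes {1..k}} \<times> ?B)"
  proof (rule sum.mono_neutral_right')
    show "{u. u permutes {1..k}} \<times> ?B \<subseteq> {u. u permutes {1..k}} \<times> tuples k"
      by (auto simp: tuples_box_def)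
    show "\<forall>p\<in>{u. u permutes {1..k}} \<times> tuples k - {u. u permutes {1..k}} \<times> ?B.
        affine_term t k r g e p = 0"
    proof
      fix p assume p: "p \<in> {u. u permutes {1..k}} \<times> tuples k - {u. u permutes {1..k}} \<times> ?B"
      show "affine_term t k r g e p = 0"
      proof (cases p)
        case (Pair u y)
        with p have "u permutes {1..k}" "y \<in> tuples k - ?B" by auto
        then show ?thesis unfolding Pair by (rule affine_term_outside_box[OF k _ _ g e])
      qed
    qed
  qed
  also have "\<dots> = sum (affine_term t k r g e) ({u. u permutes {1..k}} \<times> ?B)"
    by (rule sum.eq_sum) (intro finite_cartesian_product finite_permutations finite_tuples_box finite_atLeastAtMost)
  also have "\<dots> = (\<Sum>u | u permutes {1..k}. \<Sum>y\<in>?B. affine_term t k r g e (u, y))"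
    by (simp add: sum.cartesian_product)
  also have "\<dots> = (\<Sum>y\<in>?B. \<Sum>u | u permutes {1..k}. affine_term t k r g e (u, y))"
    by (rule sum.swap)
  finally show ?thesis .
qed

definition affine_sum :: "'a::field \<Rightarrow> nat \<Rightarrow> nat \<Rightarrow> (int \<Rightarrow> 'a) \<Rightarrow> 'a" where
  "affine_sum t k r e = sum' (affine_term t k r e e) ({u. u permutes {1..k}} \<times> tuples k)"

text \<open>Both sums reduce to the same finite box, where the double sum is an iterated
  one.\<close>

lemma sum'_det1_eq_affine_sum:
  assumes t: "t \<noteq> 0" and k: "k > 0" and e: "\<And>c. c < 0 \<or> c > int N \<Longrightarrow> e c = 0"
  shows "sum' (\<lambda>y. det1 k (\<lambda>i j. t powi weight k i (y i) * e (int r - int i + int j - int k * y i))) (tuples k) =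
         affine_sum t k r e"
proof -
  have det: "det1 k (\<lambda>i j. t powi weight k i (y i) * e (int r - int i + int j - int k * y i)) =
     (\<Sum>u | u permutes {1..k}. affine_term t k r e e (u, y))" for y
    using det1_eq_sum_affine_term[OF t k, of y e e r] by simp
  have "sum' (\<lambda>y. \<Sum>u | u permutes {1..k}. affine_term t k r e e (u, y)) (tuples k) =
        sum' (\<lambda>y. \<Sum>u | u permutes {1..k}. affine_term t k r e e (u, y)) (tuples_box k (r + k + N))"
  proof (rule sum.mono_neutral_right')
    show "tuples_box k (r + k + N) \<subseteq> tuples k" by (auto simp: tuples_box_def)
    show "\<forall>y\<in>tuples k - tuples_box k (r + k + N). (\<Sum>u | u permutes {1..k}. affine_term t k r e e (u, y)) = 0"
      by (intro ballI sum.neutral) (auto intro!: affine_term_outside_box[OF k _ _ e e])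
  qed
  then show ?thesis
    by (simp only: det affine_sum_def sum'_affine_term[OF k e e] sum.eq_sum[OF finite_tuples_box])
qed

lemma affine_sum_step:
  fixes x :: "'b \<Rightarrow> 'a::field"
  assumes t: "t \<noteq> 0" and k: "k > 0"
    and V: "finite V" and inj: "inj_on x V" and nz: "\<And>i. i \<in> V \<Longrightarrow> x i \<noteq> 0"
  shows "(1 - t) * (\<Sum>b\<in>V. hl_coeff t x V b * affine_sum t k r (esym x (V - {b}))) =
         (1 - t powi (int (card V) - int r)) * affine_sum t k r (esym x V)"
proof -
  let ?N = "card V"
  let ?e = "esym x V"
  \<comment> \<open>All columns but the first are fixed to \<open>e(V, _)\<close>, which makes
    \<open>L\<close> linear in \<open>g\<close>.\<close>
  define L where "L = (\<lambda>g. \<Sum>y\<in>tuples_box k (r + k + ?N). \<Sum>u | u permutes {1..k}. affine_term t k r g ?e (u, y))"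
  have e0: "?e c = 0" if "c < 0 \<or> c > int ?N" for c
    using esym_eq_0[OF V that] .
  have R: "affine_sum t k r ?e = L ?e"
    unfolding affine_sum_def L_def by (rule sum'_affine_term[OF k e0 e0])
  have Rb: "affine_sum t k r (esym x (V - {b})) = L (esym x (V - {b}))" if b: "b \<in> V" for b
  proof -
    \<comment> \<open>The bound stays \<open>card V\<close> although a variable is missing, so that
      all \<open>b\<close> share one box.\<close>
    have eb: "esym x (V - {b}) c = 0" if "c < 0 \<or> c > int ?N" for c
      by (rule esym_eq_0) (use V that card_Diff1_le[of V b] in auto)
    have "?e c = esym x (V - {b}) c + x b * esym x (V - {b}) (c - 1)" for c
      using esym_insert[of "V - {b}" b x c] V b by (simp add: insert_absorb)
    note column = sum_affine_term_column[where e = ?e and e' = "esym x (V - {b})", OF t k this]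
    have "affine_sum t k r (esym x (V - {b})) = (\<Sum>y\<in>tuples_box k (r + k + ?N).
        \<Sum>u | u permutes {1..k}. affine_term t k r (esym x (V - {b})) (esym x (V - {b})) (u, y))"
      unfolding affine_sum_def by (rule sum'_affine_term[OF k eb eb])
    also have "\<dots> = L (esym x (V - {b}))"
      unfolding L_def by (rule sum.cong[OF refl]) (rule column[symmetric])
    finally show ?thesis .
  qed
  have lin_sum: "L (\<lambda>c. \<Sum>b\<in>V. a b * f b c) = (\<Sum>b\<in>V. a b * L (f b))" for a f
  proof -
    have "affine_term t k r (\<lambda>c. \<Sum>b\<in>V. a b * f b c) ?e p = (\<Sum>b\<in>V. a b * affine_term t k r (f b) ?e p)" for p
      by (cases p) (simp add: affine_term_def sum_distrib_left sum_distrib_right mult_ac)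
    then have "L (\<lambda>c. \<Sum>b\<in>V. a b * f b c) =
       (\<Sum>y\<in>tuples_box k (r + k + ?N). \<Sum>b\<in>V. \<Sum>u | u permutes {1..k}. a b * affine_term t k r (f b) ?e (u, y))"
      unfolding L_def by (simp only:) (intro sum.cong refl sum.swap)
    also have "\<dots> = (\<Sum>b\<in>V. \<Sum>y\<in>tuples_box k (r + k + ?N). \<Sum>u | u permutes {1..k}. a b * affine_term t k r (f b) ?e (u, y))"
      by (rule sum.swap)
    finally show ?thesis by (simp only: L_def sum_distrib_left)
  qed
  have lin_diff: "L (\<lambda>c. f c - a * h c) = L f - a * L h" for f a h
  proof -
    have "affine_term t k r (\<lambda>c. f c - a * h c) ?e p = affine_term t k r f ?e p - a * affine_term t k r h ?e p" for p
      by (cases p) (simp add: affine_term_def algebra_simps)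
    then show ?thesis by (simp add: L_def sum_subtractf sum_distrib_left)
  qed
  define h where "h = (\<lambda>c. t powi (int r - c) * ?e c)"
  have h0: "h c = 0" if "c < 0 \<or> c > int ?N" for c
    using e0[OF that] by (simp add: h_def)
  have "L h = sum' (affine_term t k r h ?e) ({u. u permutes {1..k}} \<times> tuples k)"
    unfolding L_def by (rule sum'_affine_term[OF k h0 e0, symmetric])
  also have "\<dots> = L ?e"
    unfolding h_def sum'_affine_term_rotate[OF t k] R[symmetric] affine_sum_def ..
  finally have rotate: "L h = L ?e" .
  have "(1 - t) * (\<Sum>b\<in>V. hl_coeff t x V b * affine_sum t k r (esym x (V - {b}))) =
        (\<Sum>b\<in>V. ((1 - t) * hl_coeff t x V b) * L (esym x (V - {b})))"
    unfolding sum_distrib_left by (rule sum.cong) (simp_all add: Rb mult.assoc)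
  also have "\<dots> = L (\<lambda>c. (1 - t) * (\<Sum>b\<in>V. hl_coeff t x V b * esym x (V - {b}) c))"
    by (simp only: lin_sum[symmetric]) (simp only: sum_distrib_left mult.assoc)
  also have "(\<lambda>c. (1 - t) * (\<Sum>b\<in>V. hl_coeff t x V b * esym x (V - {b}) c)) =
             (\<lambda>c. ?e c - t powi (int ?N - int r) * h c)"
  proof
    fix c
    \<comment> \<open>Splitting off \<open>t powi (r - c)\<close> leaves a constant factor, the one
      in the eigenvalue.\<close>
    have "t powi (int ?N - c) = t powi (int ?N - int r) * t powi (int r - c)"
      using power_int_add[of t "int ?N - int r" "int r - c"] t by simp
    then have "(1 - t powi (int ?N - c)) * ?e c = ?e c - t powi (int ?N - int r) * h c"
      by (simp add: h_def algebra_simps)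
    with sum_hl_coeff_esym[OF V inj nz t, of c]
    show "(1 - t) * (\<Sum>b\<in>V. hl_coeff t x V b * esym x (V - {b}) c) = ?e c - t powi (int ?N - int r) * h c"
      by (rule trans)
  qed
  also have "L \<dots> = (1 - t powi (int ?N - int r)) * L ?e"
    unfolding lin_diff rotate by (simp add: algebra_simps)
  finally show ?thesis unfolding R .
qed

section \<open>The determinantal sum in at most \<open>r\<close> variables\<close>

lemma sum_index:
  assumes u: "u permutes {1..k}" and y: "y \<in> tuples k"
  shows "(\<Sum>j=1..k. index k r u y j) = int k * int r"
proof -
  have perm: "(\<Sum>j=1..k. f (u j)) = (\<Sum>j=1..k. f j)" for f :: "nat \<Rightarrow> int"
    using sum.permute[OF u, of f] by (simp add: o_def)
  have "(\<Sum>j=1..k. y j) = 0" using y by (simp add: tuples_def)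
  then show ?thesis
    using perm[of int] perm[of y]
    by (simp add: index_def sum.distrib sum_subtractf sum_distrib_left[symmetric])
qed

text \<open>The degrees in a term have average \<open>r\<close>, but nonzero factors have degree at
  most \<open>N < r\<close>.\<close>

lemma affine_sum_eq_0:
  assumes e: "\<And>c. c < 0 \<or> c > int N \<Longrightarrow> e c = 0" and N: "N < r" and k: "k > 0"
  shows "affine_sum t k r e = 0"
proof -
  have "affine_term t k r e e (u, y) = 0" if u: "u permutes {1..k}" and y: "y \<in> tuples k" for u y
  proof (rule ccontr)
    assume nz: "affine_term t k r e e (u, y) \<noteq> 0"
    have "int k * int r = (\<Sum>j=1..k. index k r u y j)"
      using sum_index[OF u y] by simp
    also have "\<dots> \<le> (\<Sum>j=1..k. int N)"
      using affine_term_neq_0[OF nz e e] by (intro sum_mono) auto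
    also have "\<dots> < int k * int r" using N k by simp
    finally show False by simp
  qed
  then have "affine_sum t k r e = sum' (affine_term t k r e e) {}"
    unfolding affine_sum_def by (intro sum.mono_neutral_right') auto
  then show ?thesis by simp
qed

text \<open>The degrees have average \<open>r\<close> and none exceeds \<open>r\<close>, so all
  equal \<open>r\<close>. Then \<open>j - u j\<close> is a multiple of \<open>k\<close> of absolute
  value less than \<open>k\<close>, so only the identity with \<open>y = 0\<close> remains.\<close>

lemma affine_sum_full:
  assumes e: "\<And>c. c < 0 \<or> c > int r \<Longrightarrow> e c = 0" and k: "k > 0"
  shows "affine_sum t k r e = e (int r) ^ k"
proof -
  define z where "z = (\<lambda>i\<in>{1..k}. 0 :: int)"
  have "u = id \<and> y = z"
    if u: "u permutes {1..k}" and y: "y \<in> tuples k" and nz: "affine_term t k r e e (u, y) \<noteq> 0" for u y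
  proof -
    have le: "index k r u y j \<le> int r" if "j \<in> {1..k}" for j
      using affine_term_neq_0[OF nz e e that] by simp
    have "(\<Sum>j=1..k. int r - index k r u y j) = 0"
      using sum_index[OF u y, of r] by (simp add: sum_subtractf)
    then have eq: "\<forall>j\<in>{1..k}. int r - index k r u y j = 0"
      using le by (subst (asm) sum_nonneg_eq_0_iff) auto
    have uj: "u j = j \<and> y (u j) = 0" if j: "j \<in> {1..k}" for j
    proof -
      have ujk: "u j \<in> {1..k}" using permutes_in_image[OF u] j by blast
      have 1: "int j - int (u j) = int k * y (u j)"
        using eq j by (simp add: index_def algebra_simps)
      have "\<bar>int j - int (u j)\<bar> < int k" using j ujk by auto
      with 1 have "int k * \<bar>y (u j)\<bar> < int k * 1" by (simp add: abs_mult)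
      then have "y (u j) = 0" by (simp only: mult_less_cancel_left) (use k in auto)
      with 1 show ?thesis by simp
    qed
    have "u = id" using uj permutes_not_in[OF u] by (auto simp: fun_eq_iff)
    moreover have "y = z"
    proof (rule extensionalityI)
      show "y \<in> extensional {1..k}" using y by (auto simp: tuples_def PiE_def)
      show "z \<in> extensional {1..k}" by (simp add: z_def)
      show "y i = z i" if "i \<in> {1..k}" for i
        using uj[OF that] that by (auto simp: z_def)
    qed
    ultimately show ?thesis by simp
  qed
  moreover have "(id, z) \<in> {u. u permutes {1..k}} \<times> tuples k"
    by (simp add: permutes_id tuples_def z_def)
  ultimately have "affine_sum t k r e = sum' (affine_term t k r e e) {(id, z)}"
    unfolding affine_sum_def by (intro sum.mono_neutral_right') auto
  also have "\<dots> = affine_term t k r e e (id, z)" by simp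
  also have "\<dots> = (\<Prod>j=1..k. e (index k r id z j))"
    unfolding prod_first[OF k] by (simp add: affine_term_def weight_def z_def)
  also have "\<dots> = (\<Prod>j=1..k. e (int r))"
    by (rule prod.cong) (simp_all add: index_def z_def)
  finally show ?thesis by simp
qed

section \<open>Comparison of both sides by induction on the number of variables\<close>

lemma hl_sum_replicate:
  fixes x :: "nat \<Rightarrow> 'a::field"
  assumes t: "t \<noteq> 0" "\<And>m. m > 0 \<Longrightarrow> t ^ m \<noteq> 1" and k: "k > 0" and n: "r \<le> n"
    and inj: "inj_on x {1..n}" and nz: "0 \<notin> x ` {1..n}"
  shows "hl_sum n (replicate r k) x t = hl_v n (replicate r k) t * affine_sum t k r (esym x {1..n})"
  using n inj nz
proof (induction n arbitrary: x rule: dec_induct)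
  case base
  have t1: "t \<noteq> 1" using t(2)[of 1] by simp
  have e0: "esym x {1..r} c = 0" if "c < 0 \<or> c > int r" for c
    by (rule esym_eq_0) (use that in simp_all)
  have "affine_sum t k r (esym x {1..r}) = (\<Prod>i=1..r. x i) ^ k"
    using affine_sum_full[OF e0 k, where t = t] esym_card[of "{1..r}" x] by simp
  moreover have "hl_v r (replicate r k) t = qpoch t r / (1 - t) ^ r"
    by (simp add: hl_v_replicate qpoch_def)
  ultimately show ?case
    using hl_sum_replicate_full[OF t(1) t1 base] by (simp only: mult.commute)
next
  case (step n)
  have t1: "1 - t \<noteq> 0" using t(2)[of 1] by simp
  let ?V = "{1..Suc n}"
  let ?la = "replicate r k"
  have "hl_sum (Suc n) ?la x t = (\<Sum>b\<in>?V. hl_coeff t x ?V b * hl_sum n ?la (x \<circ> transpose (Suc n) b) t)"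
    by (rule hl_sum_Suc) (use step.hyps in simp)
  also have "\<dots> = (\<Sum>b\<in>?V. hl_v n ?la t * (hl_coeff t x ?V b * affine_sum t k r (esym x (?V - {b}))))"
  proof (rule sum.cong[OF refl])
    fix b assume b: "b \<in> ?V"
    have "(x \<circ> transpose (Suc n) b) ` {1..n} \<subseteq> x ` ?V"
      using transpose_Suc_image[OF b] by (auto simp: image_comp[symmetric])
    then have "0 \<notin> (x \<circ> transpose (Suc n) b) ` {1..n}" using step.prems(2) by blast
    with inj_on_comp_transpose[OF b step.prems(1)]
    have "hl_sum n ?la (x \<circ> transpose (Suc n) b) t =
      hl_v n ?la t * affine_sum t k r (esym (x \<circ> transpose (Suc n) b) {1..n})"
      by (rule step.IH)
    also have "esym (x \<circ> transpose (Suc n) b) {1..n} = esym x (?V - {b})"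
      using esym_reindex[of "transpose (Suc n) b" "{1..n}" x] transpose_Suc_image[OF b]
      by (simp only: inj_on_subset[OF inj_transpose subset_UNIV])
    finally show "hl_coeff t x ?V b * hl_sum n ?la (x \<circ> transpose (Suc n) b) t =
      hl_v n ?la t * (hl_coeff t x ?V b * affine_sum t k r (esym x (?V - {b})))"
      by (simp only: mult_ac)
  qed
  also have "\<dots> = hl_v n ?la t * (\<Sum>b\<in>?V. hl_coeff t x ?V b * affine_sum t k r (esym x (?V - {b})))"
    by (simp only: sum_distrib_left)
  also have "(\<Sum>b\<in>?V. hl_coeff t x ?V b * affine_sum t k r (esym x (?V - {b}))) =
     (1 - t ^ (Suc n - r)) / (1 - t) * affine_sum t k r (esym x ?V)"
  proof -
    have "(1 - t) * (\<Sum>b\<in>?V. hl_coeff t x ?V b * affine_sum t k r (esym x (?V - {b}))) =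
         (1 - t powi (int (card ?V) - int r)) * affine_sum t k r (esym x ?V)"
      by (rule affine_sum_step[OF t(1) k _ step.prems(1)]) (use step.prems(2) in force)+
    also have "int (card ?V) - int r = int (Suc n - r)" using step.hyps by simp
    finally show ?thesis
      using t1 by (simp only: power_int_of_nat) (metis (no_types, lifting) nonzero_mult_div_cancel_left times_divide_eq_left)
  qed
  \<comment> \<open>Passing from \<open>n\<close> to \<open>Suc n\<close> multiplies
    \<open>hl_v\<close> by exactly this quotient.\<close>
  also have "hl_v n ?la t * ((1 - t ^ (Suc n - r)) / (1 - t) * affine_sum t k r (esym x ?V)) =
     hl_v (Suc n) ?la t * affine_sum t k r (esym x ?V)"
    using step.hyps by (simp add: hl_v_replicate qpoch_def Suc_diff_le mult_ac)
  finally show ?case .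
qed

text \<open>For \<open>r \<le> n\<close> the factor \<open>hl_v\<close> can be divided out, since no
  positive power of \<open>t\<close> is 1; for \<open>r > n\<close> both sides vanish.\<close>

lemma hall_littlewood_replicate:
  fixes x :: "nat \<Rightarrow> 'a::field"
  assumes t: "t \<noteq> 0" "\<And>m. m > 0 \<Longrightarrow> t ^ m \<noteq> 1" and k: "k > 0"
    and inj: "inj_on x {1..n}" and nz: "0 \<notin> x ` {1..n}"
  shows "hall_littlewood n (replicate r k) x t = affine_sum t k r (esym x {1..n})"
proof (cases "r \<le> n")
  case True
  have "qpoch t m \<noteq> 0" for m
    unfolding qpoch_def using t(2) by (auto simp: eq_commute[of "1::'a"])
  moreover have "1 - t \<noteq> 0" using t(2)[of 1] by simp
  ultimately have "hl_v n (replicate r k) t \<noteq> 0"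
    by (simp add: hl_v_replicate)
  then show ?thesis
    using hl_sum_replicate[OF t k True inj nz] True
    by (simp add: hall_littlewood_def hl_sum_def)
next
  case False
  have "esym x {1..n} c = 0" if "c < 0 \<or> c > int n" for c
    by (rule esym_eq_0) (use that in simp_all)
  then have "affine_sum t k r (esym x {1..n}) = 0"
    by (rule affine_sum_eq_0) (use False k in auto)
  then show ?thesis using False by (simp add: hall_littlewood_def)
qed

lemma xvar_neq_0: "xvar i \<noteq> 0"
proof
  assume "xvar i = 0"
  then have "Poly_Mapping.single (Poly_Mapping.single i (1::nat)) (1::int poly) = 0"
    by (simp add: xvar_def)
  then show False by (metis lookup_single_eq lookup_zero zero_neq_one)
qed

lemma tvar_neq_0: "tvar \<noteq> 0"
proof
  assume "tvar = 0"
  then have "Poly_Mapping.single 0 [:0, 1:] = (0 :: (nat \<Rightarrow>\<^sub>0 nat) \<Rightarrow>\<^sub>0 int poly)"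
    by (simp add: tvar_def)
  then have "[:0, 1:] = (0 :: int poly)" by (metis lookup_single_eq lookup_zero)
  then show False by simp
qed

theorem theorem1p1:
  fixes k r n :: nat
  assumes "k > 0"
  shows "hall_littlewood n (replicate r k) xvar tvar =
    sum' (\<lambda>y. det1 k (\<lambda>i j.
             tvar powi (int k * ((y i * (y i - 1)) div 2) + int i * y i) *
             elem_sym n xvar (int r - int i + int j - int k * y i)))
         {y \<in> {1..k} \<rightarrow>\<^sub>E (UNIV :: int set). (\<Sum>i=1..k. y i) = 0}"
proof -
  have "esym xvar {1..n} c = 0" if "c < 0 \<or> c > int n" for c
    by (rule esym_eq_0) (use that in simp_all)
  note sum'_det1_eq_affine_sum[where e = "esym xvar {1..n}" and r = r, OF tvar_neq_0 assms this]
  moreover have "hall_littlewood n (replicate r k) xvar tvar = affine_sum tvar k r (esym xvar {1..n})"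
    by (rule hall_littlewood_replicate[OF tvar_neq_0 tvar_power_neq_1 assms])
      (auto simp: inj_on_def xvar_neq_0 image_iff eq_commute[of 0])
  ultimately have "hall_littlewood n (replicate r k) xvar tvar =
    sum' (\<lambda>y. det1 k (\<lambda>i j. tvar powi weight k i (y i) *
      esym xvar {1..n} (int r - int i + int j - int k * y i))) (tuples k)"
    by (simp only:)
  then show ?thesis
    by (simp only: weight_def tuples_def elem_sym_eq_esym)
qed

end
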